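(* Let $\alpha>0$ and let $F^2_\alpha$ be the space of entire functions $f$ with $\|f\|_\alpha^2=\frac\alpha\pi\int_{\mathbb C}|f(z)|^2e^{-\alpha|z|^2}\,dA(z)<\infty$. If $f,g\in F^2_\alpha$ and $|f(z)|\le|g(z)|$ for $|z|>1/\sqrt\alpha$, then $\|f\|_\alpha\le\|g\|_\alpha$. The Korenblum radius of $F^2_\alpha$ is $1/\sqrt\alpha$.
   Context: $dA$ is area measure on $\mathbb C$. A radius $R>0$ is admissible for $F^2_\alpha$ if $\|f\|_\alpha\le\|g\|_\alpha$ for all $f,g\in F^2_\alpha$ with $|f(z)|\le|g(z)|$ for $|z|>R$. The Korenblum radius of $F^2_\alpha$ is the supremum of the admissible radii. *)

theory Defs
  imports "HOL-Analysis.Analysis"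
begin

definition fock_space :: "real \<Rightarrow> (complex \<Rightarrow> complex) set" where
  "fock_space \<alpha> = {f. f holomorphic_on UNIV \<and>
     integrable lborel (\<lambda>z. (cmod (f z))\<^sup>2 * exp (- \<alpha> * (cmod z)\<^sup>2))}"

definition fock_norm :: "real \<Rightarrow> (complex \<Rightarrow> complex) \<Rightarrow> real" where
  "fock_norm \<alpha> f =
     sqrt (\<alpha> / pi * (LINT z|lborel. (cmod (f z))\<^sup>2 * exp (- \<alpha> * (cmod z)\<^sup>2)))"

definition fock_admissible :: "real \<Rightarrow> real \<Rightarrow> bool" where
  "fock_admissible \<alpha> R \<longleftrightarrow> R > 0 \<and>
     (\<forall>f\<in>fock_space \<alpha>. \<forall>g\<in>fock_space \<alpha>.
        (\<forall>z. cmod z > R \<longrightarrow> cmod (f z) \<le> cmod (g z)) \<longrightarrow> fock_norm \<alpha> f \<le> fock_norm \<alpha> g)"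

(* The supremum is taken in the extended reals: Sup on type real is unspecified for
   empty or unbounded sets. *)
definition korenblum_radius :: "real \<Rightarrow> ereal" where
  "korenblum_radius \<alpha> = (SUP R\<in>{R. fock_admissible \<alpha> R}. ereal R)"

end

theory Submission
  imports Defs "HOL-Complex_Analysis.Complex_Analysis" "HOL-Probability.Distributions"
begin

text \<open>
  Put \<open>R = 1 / sqrt \<alpha>\<close>. If \<open>\<bar>f\<bar> \<le> \<bar>g\<bar>\<close> outside the disc of radius \<open>R\<close>, then
  \<open>f z = \<phi> (1/z) * g z\<close> there, with \<open>\<phi>\<close> holomorphic and bounded by 1 near 0 (removable singularities).
  Multiplication by \<open>\<phi> (1/z)\<close> only lowers degrees, so it commutes with taking tails of power series
  modulo terms of lower degree; by orthogonality on circles, every tail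
  \<open>\<Sum>n\<ge>k. \<bar>f\<^sub>n\<bar>\<^sup>2 R\<^sup>2\<^sup>n\<close> is at most the corresponding tail for \<open>g\<close>. This is von Neumann's
  inequality for the backward shift, made explicit.
  The squared Fock norm is a positive combination of these tails, because it equals
  \<open>\<Sum>n. \<bar>f\<^sub>n\<bar>\<^sup>2 m\<^sub>n\<close> up to a factor, where \<open>m\<^sub>n\<close> is the Gaussian integral of \<open>\<bar>z\<bar>\<^sup>2\<^sup>n\<close>, and
  \<open>m\<^sub>n / R\<^sup>2\<^sup>n\<close> is nondecreasing in \<open>n\<close>.
  For \<open>R' > R\<close> the constant function \<open>R'\<close> and the identity show that \<open>R'\<close> is not admissible.
\<close>

section \<open>Rotation invariance of planar Lebesgue measure\<close>

text \<open>Lebesgue measure is determined by its values on boxes. The preimage of a box under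
  \<open>T\<close> is its image under the inverse \<open>T'\<close>, again orthogonal, and
  orthogonal images preserve volume.\<close>

lemma lborel_distr_orthogonal:
  fixes T :: "real^'n::{finite,wellorder} \<Rightarrow> real^'n::{finite,wellorder}"
  assumes T: "orthogonal_transformation T"
  shows "distr lborel borel T = lborel"
proof (rule lborel_eqI[symmetric])
  obtain T' where T': "orthogonal_transformation T'" "\<And>x. T' (T x) = x" "\<And>x. T (T' x) = x"
    using orthogonal_transformation_inv[OF T] orthogonal_transformation_bij[OF T]
    by (metis bij_inv_eq_iff)
  fix l u :: "(real,'n) vec"
  assume le: "\<And>b. b \<in> Basis \<Longrightarrow> l \<bullet> b \<le> u \<bullet> b"
  have lin: "linear T"
    using T by (rule orthogonal_transformation_linear)
  then have [measurable]: "T \<in> borel_measurable borel"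
    by (intro borel_measurable_continuous_onI linear_continuous_on linear_conv_bounded_linear[THEN iffD1])
  have eq: "T -` box l u = T' ` box l u"
    using T' by (auto simp: image_iff) metis
  have fin: "emeasure lborel (T -` box l u) < \<infinity>"
  proof (rule emeasure_bounded_finite)
    show "bounded (T -` box l u)"
      unfolding eq using T'(1)
      by (intro bounded_linear_image bounded_box linear_conv_bounded_linear[THEN iffD1] orthogonal_transformation_linear)
  qed
  have "emeasure (distr lborel borel T) (box l u) = emeasure lborel (T -` box l u)"
    by (simp add: emeasure_distr)
  also have "\<dots> = ennreal (measure lborel (T -` box l u))"
    using fin by (intro emeasure_eq_ennreal_measure) auto
  also have "measure lborel (T -` box l u) = measure lebesgue (T' ` box l u)"
    unfolding eq[symmetric] by (rule measure_completion[symmetric]) (use measurable_sets[of T borel borel "box l u"] in simp)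
  also have "\<dots> = measure lebesgue (box l u)"
    by (rule measure_orthogonal_image) (use T' in auto)
  also have "\<dots> = (\<Prod>b\<in>Basis. (u - l) \<bullet> b)"
    using le by (simp)
  finally show "emeasure (distr lborel borel T) (box l u) = (\<Prod>b\<in>Basis. (u - l) \<bullet> b)" .
qed simp

text \<open>Orthogonal maps are available on Cartesian vectors only; this identification carries
  their invariance over to the complex plane.\<close>

lemma lborel_complex_eq_distr_vec2:
  "(lborel :: complex measure) = distr (lborel :: (real^2) measure) borel (\<lambda>v. Complex (v $ 1) (v $ 2))"
    (is "_ = distr _ _ ?C")
proof (rule lborel_eqI)
  fix l u :: complex
  assume le: "\<And>b. b \<in> Basis \<Longrightarrow> l \<bullet> b \<le> u \<bullet> b"
  define V :: "complex \<Rightarrow> real^2" where "V z = vector [Re z, Im z]" for z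
  have [measurable]: "?C \<in> borel_measurable borel"
    by (intro borel_measurable_continuous_onI continuous_on_Complex continuous_intros)
  have "?C -` box l u = box (V l) (V u)"
    by (auto simp: V_def in_box_complex_iff mem_box_cart forall_2)
  then have "emeasure (distr lborel borel ?C) (box l u) = emeasure lborel (box (V l) (V u))"
    by (simp add: emeasure_distr)
  also have "\<dots> = (\<Prod>b\<in>Basis. (V u - V l) \<bullet> b)"
  proof (rule emeasure_lborel_box)
    fix b :: "real^2" assume "b \<in> Basis"
    then have "b = axis 1 1 \<or> b = axis 2 1"
      by (auto simp: Basis_vec_def) (metis exhaust_2)
    then show "V l \<bullet> b \<le> V u \<bullet> b"
      using le[of 1] le[of \<i>] by (auto simp: V_def inner_axis Basis_complex_def inner_complex_def)
  qed
  also have "(\<Prod>b\<in>Basis. (V u - V l) \<bullet> b) = (\<Prod>b\<in>Basis. (u - l) \<bullet> b)"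
    by (simp add: V_def prod.reindex Basis_vec_def axis_eq_axis inj_on_def UNION_singleton_eq_range inner_axis UNIV_2 Basis_complex_def)
  finally show "emeasure (distr lborel borel ?C) (box l u) = (\<Prod>b\<in>Basis. (u - l) \<bullet> b)" .
qed simp

text \<open>In real coordinates multiplication by \<open>c\<close> is the linear map
  \<open>T\<close>, which preserves the norm by the two-square identity. The coordinate map
  \<open>C\<close> intertwines the two.\<close>

lemma lborel_distr_rotation:
  fixes c :: complex
  assumes c: "cmod c = 1"
  shows "distr lborel borel ((*) c) = lborel"
proof -
  define C where "C v = Complex (v $ 1) (v $ 2)" for v :: "real^2"
  define T :: "real^2 \<Rightarrow> real^2" where
    "T v = vector [Re c * v $ 1 - Im c * v $ 2, Re c * v $ 2 + Im c * v $ 1]" for v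
  have [measurable]: "C \<in> borel_measurable borel"
    unfolding C_def by (intro borel_measurable_continuous_onI continuous_on_Complex continuous_intros)
  have c2: "(Re c)\<^sup>2 + (Im c)\<^sup>2 = 1"
    using c by (simp add: cmod_def)
  have norm_T: "norm (T v) = norm v" for v
  proof -
    have "(Re c * v $ 1 - Im c * v $ 2)\<^sup>2 + (Re c * v $ 2 + Im c * v $ 1)\<^sup>2
        = ((Re c)\<^sup>2 + (Im c)\<^sup>2) * ((v $ 1)\<^sup>2 + (v $ 2)\<^sup>2)"
      by algebra
    then show ?thesis
      by (simp add: norm_vec_def L2_set_def UNIV_2 T_def c2)
  qed
  have lin: "linear T"
    by (rule linearI) (simp_all add: T_def vec_eq_iff forall_2 algebra_simps)
  then have T: "orthogonal_transformation T"
    using norm_T by (simp add: orthogonal_transformation)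
  have [measurable]: "T \<in> borel_measurable borel"
    using lin by (intro borel_measurable_continuous_onI linear_continuous_on linear_conv_bounded_linear[THEN iffD1])
  have CT: "(*) c \<circ> C = C \<circ> T"
    by (auto simp: fun_eq_iff C_def T_def complex_eq_iff)
  have C: "lborel = distr lborel borel C"
    unfolding C_def by (rule lborel_complex_eq_distr_vec2)
  have "distr lborel borel ((*) c) = distr lborel borel ((*) c \<circ> C)"
    by (subst C, subst distr_distr) auto
  also have "\<dots> = distr (distr lborel borel T) borel C"
    unfolding CT by (subst distr_distr) auto
  also have "\<dots> = lborel"
    using lborel_distr_orthogonal[OF T] C by simp
  finally show ?thesis .
qed

section \<open>Holomorphic quotients of dominated functions\<close>

text \<open>The quotient of \<open>f\<close> by \<open>g\<close> is bounded by 1, so its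
  singularities at zeros of \<open>g\<close> are removable and \<open>remove_sings\<close> fills
  them in. Working with meromorphic functions also covers components of \<open>U\<close> on which
  \<open>g\<close> vanishes identically; there the quotient is 0.\<close>

lemma dominated_holomorphic_quotient:
  fixes f g :: "complex \<Rightarrow> complex"
  assumes U: "open U" and f: "f holomorphic_on U" and g: "g holomorphic_on U"
    and le: "\<And>z. z \<in> U \<Longrightarrow> cmod (f z) \<le> cmod (g z)"
  obtains h where "h holomorphic_on U" "\<And>z. z \<in> U \<Longrightarrow> cmod (h z) \<le> 1"
    "\<And>z. z \<in> U \<Longrightarrow> f z = h z * g z"
proof -
  define q where "q z = f z / g z" for z
  define h where "h = remove_sings q"
  have an: "f analytic_on U" "g analytic_on U"
    using U f g by (simp_all add: analytic_on_open)
  \<comment> \<open>Since \<open>x / 0 = 0\<close>, the bound holds at the zeros of \<open>g\<close>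
    too.\<close>
  have q_le: "cmod (q z) \<le> 1" if "z \<in> U" for z
    using le[OF that] by (cases "g z = 0") (auto simp: q_def norm_divide divide_simps)
  have "q meromorphic_on U"
    unfolding q_def using an by (intro meromorphic_on_divide analytic_on_imp_meromorphic_on)
  then have mero: "q meromorphic_on {z}" if "z \<in> U" for z
    using that by (blast intro: meromorphic_on_subset)
  have *: "h analytic_on {z} \<and> cmod (h z) \<le> 1" if z: "z \<in> U" for z
  proof -
    have ev: "eventually (\<lambda>w. cmod (q w) \<le> 1) (at z)"
      using eventually_at_in_open[OF U z] by eventually_elim (auto intro: q_le)
    have "\<not> is_pole q z"
    proof
      assume "is_pole q z"
      then have "eventually (\<lambda>w. cmod (q w) \<ge> 2) (at z)"
        unfolding is_pole_def filterlim_at_infinity[OF order_refl] by simp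
      with ev have "eventually (\<lambda>w. False) (at z)"
        by eventually_elim simp
      then show False by simp
    qed
    with mero[OF z] obtain c where c: "q \<midarrow>z\<rightarrow> c"
      unfolding meromorphic_at_iff not_essential_def by auto
    have "h analytic_on {z}"
      unfolding h_def using mero[OF z] c
      by (intro remove_sings_analytic_at) (auto simp: meromorphic_at_iff)
    moreover have "h z = c"
      unfolding h_def using c by (rule remove_sings_eqI)
    moreover have "cmod c \<le> 1"
      by (rule tendsto_upperbound[OF tendsto_norm[OF c] ev]) simp
    ultimately show ?thesis by simp
  qed
  have "f z = h z * g z" if z: "z \<in> U" for z
  proof (cases "g z = 0")
    case False
    have "q analytic_on {z}"
      unfolding q_def using an z False
      by (intro analytic_on_divide) (auto intro: analytic_on_subset)
    then have "h z = q z"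
      by (simp add: h_def)
    then show ?thesis
      using False by (simp add: q_def)
  \<comment> \<open>At a zero of \<open>g\<close> the domination forces \<open>f z = 0\<close>, so
    the product formula holds whatever value \<open>h\<close> has there.\<close>
  qed (use le[OF z] in auto)
  moreover have "h holomorphic_on U"
    using * analytic_on_analytic_at analytic_imp_holomorphic by blast
  ultimately show thesis
    using * that by blast
qed

text \<open>The inversion \<open>w = 1/z\<close> turns the exterior of the disc into a punctured
  disc. The bounded quotient then extends over \<open>w = 0\<close>, that is, over infinity, by
  Riemann's theorem.\<close>

lemma dominated_entire_quotient_at_infinity:
  fixes f g :: "complex \<Rightarrow> complex"
  assumes f: "f holomorphic_on UNIV" and g: "g holomorphic_on UNIV" and R: "R > 0"
    and le: "\<And>z. cmod z > R \<Longrightarrow> cmod (f z) \<le> cmod (g z)"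
  obtains \<phi> where "\<phi> holomorphic_on ball 0 (1/R)"
    "\<And>z. cmod z > R \<Longrightarrow> cmod (\<phi> (1/z)) \<le> 1"
    "\<And>z. cmod z > R \<Longrightarrow> f z = \<phi> (1/z) * g z"
proof -
  define U where "U = {z::complex. cmod z > R}"
  have "open U"
    unfolding U_def by (intro open_Collect_less continuous_intros)
  then obtain h where h: "h holomorphic_on U" "\<And>z. z \<in> U \<Longrightarrow> cmod (h z) \<le> 1"
      "\<And>z. z \<in> U \<Longrightarrow> f z = h z * g z"
    using dominated_holomorphic_quotient[of U f g] f g le
    by (metis U_def holomorphic_on_subset mem_Collect_eq subset_UNIV)
  have inv: "1 / w \<in> U" if "w \<in> ball 0 (1/R) - {0}" for w
    using that R by (auto simp: U_def norm_divide field_simps)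
  have "(h \<circ> (\<lambda>w. 1 / w)) holomorphic_on ball 0 (1/R) - {0}"
  proof (rule holomorphic_on_compose_gen[OF _ h(1)])
    show "(\<lambda>w. 1 / w) ` (ball 0 (1/R) - {0}) \<subseteq> U"
      using inv by blast
  qed (auto intro!: holomorphic_intros)
  moreover have "eventually (\<lambda>w. w \<in> ball 0 (1/R) - {0}) (at 0)"
    using R by (intro eventually_at_in_open) auto
  then have "eventually (\<lambda>w. cmod ((h \<circ> (\<lambda>w. 1 / w)) w) \<le> 1) (at 0)"
    by eventually_elim (simp only: comp_apply inv h(2))
  moreover have "0 \<in> interior (ball (0::complex) (1/R))"
    using R by simp
  ultimately obtain \<phi> where \<phi>: "\<phi> holomorphic_on ball 0 (1/R)"
      "\<And>w. w \<in> ball 0 (1/R) - {0} \<Longrightarrow> \<phi> w = h (1 / w)"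
    using holomorphic_on_extend_bounded[of "h \<circ> (\<lambda>w. 1 / w)" "ball 0 (1/R)" 0]
    by (metis comp_apply)
  have "\<phi> (1 / z) = h z \<and> z \<in> U" if z: "cmod z > R" for z
  proof -
    have "z \<noteq> 0"
      using z R by auto
    then have "1 / z \<in> ball 0 (1/R) - {0}"
      using z R by (simp add: norm_divide field_simps)
    from \<phi>(2)[OF this] z show ?thesis
      by (simp add: U_def)
  qed
  with h \<phi>(1) show thesis
    by (intro that) auto
qed

section \<open>Power series and Parseval's identity on circles\<close>

text \<open>Cauchy's theorem on the circle: there \<open>dz\<close> is \<open>\<i> * z\<close> times
  the angle element, and multiplication by \<open>-\<i>\<close> removes the constant factor.\<close>

lemma circle_mean_zero:
  fixes h :: "complex \<Rightarrow> complex"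
  assumes h: "h holomorphic_on ball 0 r" and \<rho>: "0 \<le> \<rho>" "\<rho> < r"
  shows "((\<lambda>\<theta>. of_real \<rho> * cis \<theta> * h (of_real \<rho> * cis \<theta>)) has_integral 0) {0..2*pi}"
proof -
  have "(h has_contour_integral 0) (part_circlepath 0 \<rho> 0 (2*pi))"
  proof (rule Cauchy_theorem_disc_simple[OF h])
    show "path_image (part_circlepath 0 \<rho> 0 (2 * pi)) \<subseteq> ball 0 r"
      using \<rho> path_image_part_circlepath_subset[of 0 "2*pi" \<rho> 0] by (auto simp: sphere_def)
  qed (simp_all add: exp_two_pi_i' mult_ac)
  then have "((\<lambda>t. h (0 + of_real \<rho> * cis t) * of_real \<rho> * \<i> * cis t) has_integral 0) {0..2*pi}"
    by (subst (asm) has_contour_integral_part_circlepath_iff) auto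
  from has_integral_mult_right[OF this, of "-\<i>"] show ?thesis
    by (simp add: mult_ac)
qed

text \<open>Entire functions are handled through their coefficients, so that the iterated backward
  shift \<open>pser (\<lambda>n. a (n + k))\<close> is an object of the same kind.\<close>

definition pser :: "(nat \<Rightarrow> complex) \<Rightarrow> complex \<Rightarrow> complex" where
  "pser a z = (\<Sum>n. a n * z ^ n)"

lemma summable_norm_pser:
  assumes "\<And>z. summable (\<lambda>n. a n * z ^ n :: complex)"
  shows "summable (\<lambda>n. cmod (a n) * \<bar>\<rho>\<bar> ^ n)"
proof -
  have "summable (\<lambda>n. cmod (a n * of_real \<rho> ^ n))"
    by (rule powser_insidea[OF assms[of "of_real (\<bar>\<rho>\<bar> + 1)"]]) auto
  then show ?thesis
    by (simp add: norm_mult norm_power)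
qed

lemma holomorphic_pser:
  assumes "\<And>z. summable (\<lambda>n. a n * z ^ n :: complex)"
  shows "pser a holomorphic_on S"
proof -
  have "pser a holomorphic_on ball 0 r" for r
    by (rule power_series_holomorphic[of _ _ a]) (use assms in \<open>auto simp: pser_def summable_sums\<close>)
  then have "pser a holomorphic_on UNIV"
    unfolding holomorphic_on_open[OF open_UNIV] 
    by (metis UNIV_I centre_in_ball holomorphic_on_open mem_ball_0 open_ball linordered_field_no_ub)
  then show ?thesis
    by (rule holomorphic_on_subset) simp
qed

lemma summable_pser_shift:
  assumes "\<And>z. summable (\<lambda>n. a n * z ^ n :: complex)"
  shows "summable (\<lambda>n. a (n + k) * z ^ n)"
proof (cases "z = 0")
  case True
  show ?thesis
    by (rule summable_finite[of "{0}"]) (auto simp: True)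
next
  case False
  have "summable (\<lambda>n. a (n + k) * z ^ (n + k) / z ^ k)"
    using assms[of z, THEN summable_ignore_initial_segment, of k] by (rule summable_divide)
  then show ?thesis
    using False by (simp add: power_add)
qed

text \<open>This recursion drives both Parseval's identity and the induction on tails: each step
  splits off one coefficient.\<close>

lemma pser_shift_rec:
  assumes "\<And>z. summable (\<lambda>n. a n * z ^ n :: complex)"
  shows "pser (\<lambda>n. a (n + k)) z = a k + z * pser (\<lambda>n. a (n + Suc k)) z"
proof -
  have "pser (\<lambda>n. a (n + k)) z = a k + (\<Sum>n. z * (a (n + Suc k) * z ^ n))"
    unfolding pser_def using suminf_split_head[OF summable_pser_shift[OF assms, of k z]]
    by (simp add: algebra_simps)
  then show ?thesis
    unfolding pser_def suminf_mult[OF summable_pser_shift[OF assms, of "Suc k" z]] .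
qed


text \<open>With \<open>w = z * u z\<close> the tail equals \<open>a k + w\<close>. In the expansion
  of its squared modulus the cross term is the real part of \<open>z\<close> times a holomorphic
  function, so it has mean zero.\<close>

lemma circle_parseval_rec:
  assumes a: "\<And>z. summable (\<lambda>n. a n * z ^ n :: complex)" and \<rho>: "0 \<le> \<rho>"
    and I: "((\<lambda>\<theta>. (cmod (pser (\<lambda>n. a (n + Suc k)) (of_real \<rho> * cis \<theta>)))\<^sup>2) has_integral I) {0..2*pi}"
  shows "((\<lambda>\<theta>. (cmod (pser (\<lambda>n. a (n + k)) (of_real \<rho> * cis \<theta>)))\<^sup>2) has_integral
           (2 * pi * (cmod (a k))\<^sup>2 + \<rho>\<^sup>2 * I)) {0..2*pi}"
proof -
  define u where "u = pser (\<lambda>n. a (n + Suc k))"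
  have "(\<lambda>z. 2 * cnj (a k) * u z) holomorphic_on ball 0 (\<rho> + 1)"
    unfolding u_def by (intro holomorphic_intros holomorphic_pser summable_pser_shift a)
  from has_integral_Re[OF circle_mean_zero[OF this]] \<rho>
  have "((\<lambda>\<theta>. Re (of_real \<rho> * cis \<theta> * (2 * cnj (a k) * u (of_real \<rho> * cis \<theta>)))) has_integral 0) {0..2*pi}"
    by simp
  moreover have "((\<lambda>\<theta>. \<rho>\<^sup>2 * (cmod (u (of_real \<rho> * cis \<theta>)))\<^sup>2) has_integral \<rho>\<^sup>2 * I) {0..2*pi}"
    using I unfolding u_def by (rule has_integral_mult_right)
  moreover have "((\<lambda>\<theta>. (cmod (a k))\<^sup>2) has_integral 2 * pi * (cmod (a k))\<^sup>2) {0..2*pi}"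
    using has_integral_const_real[of "(cmod (a k))\<^sup>2" 0 "2*pi"] by simp
  ultimately have "((\<lambda>\<theta>. (cmod (a k))\<^sup>2 + \<rho>\<^sup>2 * (cmod (u (of_real \<rho> * cis \<theta>)))\<^sup>2 +
      Re (of_real \<rho> * cis \<theta> * (2 * cnj (a k) * u (of_real \<rho> * cis \<theta>)))) has_integral
      2 * pi * (cmod (a k))\<^sup>2 + \<rho>\<^sup>2 * I + 0) {0..2*pi}"
    by (intro has_integral_add)
  moreover have "(cmod (a k))\<^sup>2 + \<rho>\<^sup>2 * (cmod (u (of_real \<rho> * cis \<theta>)))\<^sup>2 +
      Re (of_real \<rho> * cis \<theta> * (2 * cnj (a k) * u (of_real \<rho> * cis \<theta>)))
      = (cmod (pser (\<lambda>n. a (n + k)) (of_real \<rho> * cis \<theta>)))\<^sup>2" for \<theta>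
  proof -
    define w where "w = of_real \<rho> * cis \<theta> * u (of_real \<rho> * cis \<theta>)"
    have "(cmod (a k + w))\<^sup>2 = (cmod (a k))\<^sup>2 + (cmod w)\<^sup>2 + Re (2 * cnj (a k) * w)"
      unfolding cmod_power2 by (simp add: power2_eq_square algebra_simps)
    moreover have "(cmod w)\<^sup>2 = \<rho>\<^sup>2 * (cmod (u (of_real \<rho> * cis \<theta>)))\<^sup>2"
      by (simp add: w_def norm_mult power_mult_distrib)
    moreover have "pser (\<lambda>n. a (n + k)) (of_real \<rho> * cis \<theta>) = a k + w"
      unfolding w_def u_def by (rule pser_shift_rec[OF a])
    ultimately show ?thesis
      by (simp add: w_def mult_ac)
  qed
  ultimately show ?thesis
    by simp
qed

lemma circle_integrable_pser:
  assumes a: "\<And>z. summable (\<lambda>n. a n * z ^ n :: complex)"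
  shows "(\<lambda>\<theta>. (cmod (pser a (z * cis \<theta>)))\<^sup>2) integrable_on {0..2*pi}"
proof (rule integrable_continuous_real)
  have "continuous_on UNIV (pser a)"
    by (intro holomorphic_on_imp_continuous_on holomorphic_pser a)
  then have "continuous_on {0..2*pi} (\<lambda>\<theta>. pser a (z * cis \<theta>))"
    by (rule continuous_on_compose2) (auto intro!: continuous_intros)
  then show "continuous_on {0..2*pi} (\<lambda>\<theta>. (cmod (pser a (z * cis \<theta>)))\<^sup>2)"
    by (intro continuous_intros)
qed

text \<open>Iterating \<open>circle_parseval_rec\<close> expresses the partial sums as
  \<open>I 0\<close> minus the remainder \<open>\<rho> ^ (2 * N) * I N\<close>, which tends to
  0.\<close>

lemma circle_parseval_real:
  assumes a: "\<And>z. summable (\<lambda>n. a n * z ^ n :: complex)" and \<rho>: "0 \<le> \<rho>"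
  shows "(\<lambda>n. 2 * pi * (cmod (a n))\<^sup>2 * \<rho> ^ (2 * n)) sums
           integral {0..2*pi} (\<lambda>\<theta>. (cmod (pser a (of_real \<rho> * cis \<theta>)))\<^sup>2)"
proof -
  define I where "I k = integral {0..2*pi} (\<lambda>\<theta>. (cmod (pser (\<lambda>n. a (n + k)) (of_real \<rho> * cis \<theta>)))\<^sup>2)" for k
  \<comment> \<open>A tail of an absolutely convergent series. It tends to 0 and majorizes
    \<open>\<rho> ^ k\<close> times the modulus of the shifted series on the circle, which controls
    the remainder.\<close>
  define \<tau> where "\<tau> k = (\<Sum>n. cmod (a (n + k)) * \<rho> ^ (n + k))" for k
  have I: "((\<lambda>\<theta>. (cmod (pser (\<lambda>n. a (n + k)) (of_real \<rho> * cis \<theta>)))\<^sup>2) has_integral I k) {0..2*pi}" for k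
    unfolding I_def by (intro integrable_integral circle_integrable_pser summable_pser_shift a)
  have rec: "I k = 2 * pi * (cmod (a k))\<^sup>2 + \<rho>\<^sup>2 * I (Suc k)" for k
    using has_integral_unique[OF I circle_parseval_rec[OF a \<rho> I]] .
  have sum: "(\<Sum>n<N. 2 * pi * (cmod (a n))\<^sup>2 * \<rho> ^ (2 * n)) = I 0 - \<rho> ^ (2 * N) * I N" for N
  proof (induction N)
    case (Suc N)
    then show ?case
      using rec[of N] by (simp add: algebra_simps power2_eq_square)
  qed simp
  have summ: "summable (\<lambda>n. cmod (a n) * \<rho> ^ n)"
    using summable_norm_pser[OF a, of \<rho>] \<rho> by simp
  have "(\<lambda>k. (\<Sum>n. cmod (a n) * \<rho> ^ n) - (\<Sum>n<k. cmod (a n) * \<rho> ^ n)) \<longlonglongrightarrow> (\<Sum>n. cmod (a n) * \<rho> ^ n) - (\<Sum>n. cmod (a n) * \<rho> ^ n)"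
    by (intro tendsto_intros summable_LIMSEQ summ)
  then have \<tau>_lim: "\<tau> \<longlonglongrightarrow> 0"
    unfolding \<tau>_def using suminf_minus_initial_segment[OF summ] by simp
  have bound: "\<rho> ^ k * cmod (pser (\<lambda>n. a (n + k)) (of_real \<rho> * cis \<theta>)) \<le> \<tau> k" for k \<theta>
  proof -
    have "\<rho> ^ k * cmod (pser (\<lambda>n. a (n + k)) (of_real \<rho> * cis \<theta>))
        \<le> \<rho> ^ k * (\<Sum>n. cmod (a (n + k)) * \<rho> ^ n)"
    proof (rule mult_left_mono)
      have *: "summable (\<lambda>n. cmod (a (n + k)) * \<rho> ^ n)"
        using summable_norm_pser[OF summable_pser_shift[OF a, of k], of \<rho>] \<rho> by simp
      show "cmod (pser (\<lambda>n. a (n + k)) (of_real \<rho> * cis \<theta>)) \<le> (\<Sum>n. cmod (a (n + k)) * \<rho> ^ n)"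
        unfolding pser_def by (rule norm_suminf_le[OF _ *]) (use \<rho> in \<open>simp add: norm_mult norm_power\<close>)
    qed (use \<rho> in simp)
    also have "\<dots> = \<tau> k"
      unfolding \<tau>_def using summable_norm_pser[OF summable_pser_shift[OF a, of k], of \<rho>] \<rho>
      by (subst suminf_mult[symmetric]) (simp_all add: power_add mult_ac)
    finally show ?thesis .
  qed
  have rem: "norm (\<rho> ^ (2 * N) * I N) \<le> 2 * pi * (\<tau> N)\<^sup>2" for N
  proof -
    have "((\<lambda>\<theta>. \<rho> ^ (2 * N) * (cmod (pser (\<lambda>n. a (n + N)) (of_real \<rho> * cis \<theta>)))\<^sup>2) has_integral \<rho> ^ (2 * N) * I N) {0..2*pi}"
      by (intro has_integral_mult_right I)
    moreover have "((\<lambda>\<theta>. (\<tau> N)\<^sup>2) has_integral 2 * pi * (\<tau> N)\<^sup>2) {0..2*pi}"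
      using has_integral_const_real[of "(\<tau> N)\<^sup>2" 0 "2*pi"] by simp
    moreover have "\<rho> ^ (2 * N) * (cmod (pser (\<lambda>n. a (n + N)) (of_real \<rho> * cis \<theta>)))\<^sup>2 \<le> (\<tau> N)\<^sup>2" for \<theta>
      using power_mono[OF bound[of N \<theta>], of 2] \<rho> by (simp add: power_mult_distrib power_even_eq)
    ultimately have "\<rho> ^ (2 * N) * I N \<le> 2 * pi * (\<tau> N)\<^sup>2"
      by (rule has_integral_le)
    moreover have "0 \<le> I N"
      by (rule has_integral_nonneg[OF I]) simp
    ultimately show ?thesis
      using \<rho> by simp
  qed
  have "(\<lambda>N. 2 * pi * (\<tau> N)\<^sup>2) \<longlonglongrightarrow> 2 * pi * 0\<^sup>2"
    by (intro tendsto_intros \<tau>_lim)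
  then have "(\<lambda>N. 2 * pi * (\<tau> N)\<^sup>2) \<longlonglongrightarrow> 0"
    by simp
  then have "(\<lambda>N. \<rho> ^ (2 * N) * I N) \<longlonglongrightarrow> 0"
    by (rule Lim_null_comparison[OF always_eventually[OF allI[OF rem]]])
  then have "(\<lambda>N. I 0 - \<rho> ^ (2 * N) * I N) \<longlonglongrightarrow> I 0 - 0"
    by (intro tendsto_intros)
  then show ?thesis
    unfolding sums_def sum by (simp add: I_def)
qed

text \<open>The argument of \<open>z\<close> is absorbed into the coefficients as
  \<open>a n * c ^ n\<close>, which leaves their moduli unchanged.\<close>

lemma circle_parseval:
  assumes a: "\<And>z. summable (\<lambda>n. a n * z ^ n :: complex)"
  shows "(\<lambda>n. 2 * pi * (cmod (a n))\<^sup>2 * cmod z ^ (2 * n)) sums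
           integral {0..2*pi} (\<lambda>\<theta>. (cmod (pser a (z * cis \<theta>)))\<^sup>2)"
proof -
  define c where "c = cis (Arg z)"
  have z: "z = of_real (cmod z) * c"
    unfolding c_def by (metis rcis_cmod_Arg rcis_def)
  define b where "b n = a n * c ^ n" for n
  have b: "summable (\<lambda>n. b n * w ^ n)" for w
    using a[of "c * w"] by (simp add: b_def power_mult_distrib mult_ac)
  have "pser a (z * w) = pser b (of_real (cmod z) * w)" for w
    unfolding pser_def b_def by (subst z) (simp add: power_mult_distrib mult_ac)
  moreover have "cmod (b n) = cmod (a n)" for n
    by (simp add: b_def c_def norm_mult norm_power)
  ultimately show ?thesis
    using circle_parseval_real[OF b, of "cmod z"] by simp
qed

section \<open>Comparison of power series tails\<close>

lemma holomorphic_on_cnj_cnj: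
  assumes f: "f holomorphic_on ball 0 r"
  shows "(\<lambda>z. cnj (f (cnj z))) holomorphic_on ball 0 r"
proof -
  have "(\<lambda>z. cnj (f (cnj z))) field_differentiable at z" if z: "z \<in> ball 0 r" for z
  proof -
    have "(f has_field_derivative deriv f (cnj z)) (at (cnj z))"
      using f z by (intro holomorphic_derivI[of f "ball 0 r"]) auto
    then have "((cnj \<circ> f \<circ> cnj) has_field_derivative cnj (deriv f (cnj z))) (at z)"
      using has_field_derivative_cnj_cnj by fastforce
    then show ?thesis
      by (auto simp: field_differentiable_def o_def)
  qed
  then show ?thesis
    by (simp add: holomorphic_on_open field_differentiable_def)
qed

text \<open>Cutting off low coefficients commutes with multiplication by \<open>\<phi> (1/z)\<close>
  up to an error containing only negative powers of \<open>z\<close>; the factor \<open>1/z\<close>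
  in front of \<open>\<psi> (1/z)\<close> records this.\<close>

lemma tail_quotient_relation:
  assumes a: "\<And>z. summable (\<lambda>n. a n * z ^ n :: complex)"
    and b: "\<And>z. summable (\<lambda>n. b n * z ^ n :: complex)"
    and \<phi>: "\<phi> holomorphic_on ball 0 (1/R)" and R: "R > 0"
    and eq: "\<And>z. cmod z > R \<Longrightarrow> pser a z = \<phi> (1/z) * pser b z"
  shows "\<exists>\<psi>. \<psi> holomorphic_on ball 0 (1/R) \<and> (\<forall>z. cmod z > R \<longrightarrow>
    \<phi> (1/z) * pser (\<lambda>n. b (n + k)) z = pser (\<lambda>n. a (n + k)) z + 1/z * \<psi> (1/z))"
proof (induction k)
  case 0
  show ?case
    using eq by (intro exI[of _ "\<lambda>_. 0"]) auto
next
  case (Suc k)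
  then obtain \<psi> where \<psi>: "\<psi> holomorphic_on ball 0 (1/R)" and
    rel: "\<And>z. cmod z > R \<Longrightarrow>
      \<phi> (1/z) * pser (\<lambda>n. b (n + k)) z = pser (\<lambda>n. a (n + k)) z + 1/z * \<psi> (1/z)"
    by blast
  \<comment> \<open>Splitting off \<open>a k\<close> and \<open>b k\<close> in the relation for
    \<open>k\<close> and dividing by \<open>z\<close> produces the new error factor. With
    \<open>w = 1/z\<close> it is the witness supplied at the end.\<close>
  have "\<phi> (1/z) * pser (\<lambda>n. b (n + Suc k)) z
      = pser (\<lambda>n. a (n + Suc k)) z + 1/z * (a k + 1/z * \<psi> (1/z) - b k * \<phi> (1/z))"
    if z: "cmod z > R" for z
  proof -
    have "z \<noteq> 0"
      using z R by auto
    moreover have "z * (\<phi> (1/z) * pser (\<lambda>n. b (n + Suc k)) z)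
        = z * pser (\<lambda>n. a (n + Suc k)) z + (a k + 1/z * \<psi> (1/z) - b k * \<phi> (1/z))"
      using rel[OF z] pser_shift_rec[OF a, of k z] pser_shift_rec[OF b, of k z]
      by (simp add: algebra_simps)
    ultimately show ?thesis
      by (simp add: field_simps del: add_Suc_right)
  qed
  then show ?case
    by (intro exI[of _ "\<lambda>w. a k + w * \<psi> w - b k * \<phi> w"]) (auto intro!: holomorphic_intros \<phi> \<psi>)
qed

text \<open>The powers of \<open>z\<close> in \<open>u\<close> are nonnegative, those in the other
  factor negative. This removes the cross term in \<open>tail_comparison\<close>.\<close>

lemma circle_orthogonal:
  assumes u: "u holomorphic_on UNIV" and \<psi>: "\<psi> holomorphic_on ball 0 (1/R)"
    and R: "0 < R" "R < \<rho>"
  shows "((\<lambda>\<theta>. u (of_real \<rho> * cis \<theta>) * cnj (1 / (of_real \<rho> * cis \<theta>) * \<psi> (1 / (of_real \<rho> * cis \<theta>))))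
    has_integral 0) {0..2*pi}"
proof -
  \<comment> \<open>on the circle \<open>1 / z = cnj z / \<rho>\<^sup>2\<close>, so the conjugated factor extends holomorphically to the disc\<close>
  define \<eta> where "\<eta> z = u z * cnj (\<psi> (cnj (z / of_real (\<rho>\<^sup>2)))) / of_real (\<rho>\<^sup>2)" for z
  \<comment> \<open>Division by \<open>\<rho>\<^sup>2\<close> maps the disc of radius
    \<open>\<rho>\<^sup>2 / R\<close> into the domain of \<open>\<psi>\<close>. This radius exceeds
    \<rho>, so Cauchy's theorem applies on the circle of radius \<rho>.\<close>
  have \<rho>: "\<rho> > 0" "\<rho> < \<rho>\<^sup>2 / R"
    using R by (auto simp: power2_eq_square field_simps)
  have "((\<lambda>z. cnj (\<psi> (cnj z))) \<circ> (\<lambda>z. z / of_real (\<rho>\<^sup>2))) holomorphic_on ball 0 (\<rho>\<^sup>2 / R)"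
    by (rule holomorphic_on_compose_gen[OF _ holomorphic_on_cnj_cnj[OF \<psi>]])
      (use \<rho> R in \<open>auto intro!: holomorphic_intros simp: norm_divide norm_power field_simps\<close>)
  then have "\<eta> holomorphic_on ball 0 (\<rho>\<^sup>2 / R)"
    unfolding \<eta>_def using \<rho>
    by (intro holomorphic_intros holomorphic_on_subset[OF u]) (auto simp: o_def)
  from circle_mean_zero[OF this] \<rho>
  have "((\<lambda>\<theta>. of_real \<rho> * cis \<theta> * \<eta> (of_real \<rho> * cis \<theta>)) has_integral 0) {0..2*pi}"
    by simp
  moreover have "of_real \<rho> * cis \<theta> * \<eta> (of_real \<rho> * cis \<theta>)
      = u (of_real \<rho> * cis \<theta>) * cnj (1 / (of_real \<rho> * cis \<theta>) * \<psi> (1 / (of_real \<rho> * cis \<theta>)))" for \<theta>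
  proof -
    define z where "z = of_real \<rho> * cis \<theta>"
    have "z * cnj z = of_real (\<rho>\<^sup>2)"
      unfolding complex_norm_square[symmetric] using \<rho> by (simp add: z_def norm_mult)
    moreover have "z \<noteq> 0"
      using \<rho> by (simp add: z_def)
    ultimately have "1 / z = cnj (z / of_real (\<rho>\<^sup>2))"
      using \<rho> by (simp add: field_simps)
    then show ?thesis
      unfolding z_def[symmetric] \<eta>_def by simp
  qed
  ultimately show ?thesis
    by simp
qed

text \<open>On the circle \<open>\<phi> (1/z) * v z = u z + y\<close> with \<open>u\<close>
  orthogonal to \<open>y\<close>, so the mean square of \<open>u\<close> is at most that of the left
  side, hence at most that of \<open>v\<close>. The squared modulus of \<open>y\<close> is dropped
  pointwise, which leaves only the cross term to integrate. Parseval translates the result into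
  coefficients.\<close>

lemma tail_comparison:
  assumes a: "\<And>z. summable (\<lambda>n. a n * z ^ n :: complex)"
    and b: "\<And>z. summable (\<lambda>n. b n * z ^ n :: complex)"
    and \<phi>: "\<phi> holomorphic_on ball 0 (1/R)" and R: "0 < R" "R < \<rho>"
    and \<phi>_le: "\<And>z. cmod z > R \<Longrightarrow> cmod (\<phi> (1/z)) \<le> 1"
    and eq: "\<And>z. cmod z > R \<Longrightarrow> pser a z = \<phi> (1/z) * pser b z"
  shows "(\<Sum>n. (cmod (a (n + k)))\<^sup>2 * \<rho> ^ (2 * n)) \<le> (\<Sum>n. (cmod (b (n + k)))\<^sup>2 * \<rho> ^ (2 * n))"
proof -
  define u where "u = pser (\<lambda>n. a (n + k))"
  define v where "v = pser (\<lambda>n. b (n + k))"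
  obtain \<psi> where \<psi>: "\<psi> holomorphic_on ball 0 (1/R)"
    and rel: "\<And>z. cmod z > R \<Longrightarrow> \<phi> (1/z) * v z = u z + 1/z * \<psi> (1/z)"
    using tail_quotient_relation[OF a b \<phi> R(1) eq] unfolding u_def v_def by blast
  have u: "u holomorphic_on UNIV"
    unfolding u_def by (intro holomorphic_pser summable_pser_shift a)
  note sa = summable_pser_shift[OF a, of k] and sb = summable_pser_shift[OF b, of k]
  define J where "J w = integral {0..2*pi} (\<lambda>\<theta>. (cmod (w (of_real \<rho> * cis \<theta>)))\<^sup>2)"
    for w :: "complex \<Rightarrow> complex"
  have Ju: "((\<lambda>\<theta>. (cmod (u (of_real \<rho> * cis \<theta>)))\<^sup>2) has_integral J u) {0..2*pi}"
    unfolding u_def J_def by (intro integrable_integral circle_integrable_pser sa)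
  have Jv: "((\<lambda>\<theta>. (cmod (v (of_real \<rho> * cis \<theta>)))\<^sup>2) has_integral J v) {0..2*pi}"
    unfolding v_def J_def by (intro integrable_integral circle_integrable_pser sb)
  have "((\<lambda>\<theta>. (cmod (u (of_real \<rho> * cis \<theta>)))\<^sup>2 +
      2 * Re (u (of_real \<rho> * cis \<theta>) * cnj (1 / (of_real \<rho> * cis \<theta>) * \<psi> (1 / (of_real \<rho> * cis \<theta>)))))
      has_integral J u + 2 * Re 0) {0..2*pi}"
    by (intro has_integral_add Ju has_integral_mult_right has_integral_Re circle_orthogonal[where R = R] u \<psi> R)
  then have "J u + 2 * Re 0 \<le> J v"
  proof (rule has_integral_le[OF _ Jv])
    fix \<theta> :: real
    define z where "z = of_real \<rho> * cis \<theta>"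
    define y where "y = 1/z * \<psi> (1/z)"
    have z: "cmod z > R"
      using R by (simp add: z_def norm_mult)
    have "(cmod (u z))\<^sup>2 + 2 * Re (u z * cnj y) \<le> (cmod (u z + y))\<^sup>2"
      unfolding cmod_power2 by (simp add: power2_eq_square algebra_simps)
    also have "\<dots> = (cmod (\<phi> (1/z)) * cmod (v z))\<^sup>2"
      using rel[OF z] by (simp add: y_def flip: norm_mult)
    also have "\<dots> \<le> (cmod (v z))\<^sup>2"
      using \<phi>_le[OF z] by (intro power_mono mult_left_le_one_le) auto
    finally show "(cmod (u (of_real \<rho> * cis \<theta>)))\<^sup>2 +
      2 * Re (u (of_real \<rho> * cis \<theta>) * cnj (1 / (of_real \<rho> * cis \<theta>) * \<psi> (1 / (of_real \<rho> * cis \<theta>))))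
      \<le> (cmod (v (of_real \<rho> * cis \<theta>)))\<^sup>2"
      by (simp only: y_def z_def)
  qed
  then have "J u \<le> J v"
    by simp
  have \<rho>: "0 \<le> \<rho>"
    using R by simp
  have "(\<lambda>n. (cmod (a (n + k)))\<^sup>2 * \<rho> ^ (2 * n)) sums (J u / (2 * pi))"
    using sums_divide[OF circle_parseval_real[OF sa \<rho>], of "2 * pi"] by (simp add: J_def u_def)
  moreover have "(\<lambda>n. (cmod (b (n + k)))\<^sup>2 * \<rho> ^ (2 * n)) sums (J v / (2 * pi))"
    using sums_divide[OF circle_parseval_real[OF sb \<rho>], of "2 * pi"] by (simp add: J_def v_def)
  ultimately show ?thesis
    using \<open>J u \<le> J v\<close> by (simp add: sums_iff divide_right_mono)
qed

lemma summable_pser_square: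
  assumes a: "\<And>z. summable (\<lambda>n. a n * z ^ n :: complex)"
  shows "summable (\<lambda>n. (cmod (a n))\<^sup>2 * \<rho> ^ (2 * n))"
proof -
  have "summable (\<lambda>n. 2 * pi * (cmod (a n))\<^sup>2 * cmod (of_real \<rho>) ^ (2 * n))"
    using circle_parseval[OF a, of "of_real \<rho>"] by (rule sums_summable)
  from summable_mult[OF this, of "1 / (2 * pi)"] show ?thesis
    by (simp add: power_mult)
qed

text \<open>Domination holds only strictly outside the disc, so \<open>tail_comparison\<close> is
  applied at radii \<rho> > R and \<rho> decreases to R. One \<open>\<phi>\<close> serves all these
  radii.\<close>

lemma tail_comparison_limit:
  assumes a: "\<And>z. summable (\<lambda>n. a n * z ^ n :: complex)"
    and b: "\<And>z. summable (\<lambda>n. b n * z ^ n :: complex)"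
    and R: "0 < R" and le: "\<And>z. cmod z > R \<Longrightarrow> cmod (pser a z) \<le> cmod (pser b z)"
  shows "(\<Sum>n. (cmod (a (n + k)))\<^sup>2 * R ^ (2 * n)) \<le> (\<Sum>n. (cmod (b (n + k)))\<^sup>2 * R ^ (2 * n))"
proof -
  obtain \<phi> where \<phi>: "\<phi> holomorphic_on ball 0 (1/R)"
    "\<And>z. cmod z > R \<Longrightarrow> cmod (\<phi> (1/z)) \<le> 1"
    "\<And>z. cmod z > R \<Longrightarrow> pser a z = \<phi> (1/z) * pser b z"
    using dominated_entire_quotient_at_infinity[OF holomorphic_pser[OF a] holomorphic_pser[OF b] R le]
    by blast
  have lim: "((\<lambda>\<rho>. \<Sum>n. (cmod (c (n + k)))\<^sup>2 * \<rho> ^ (2 * n)) \<longlongrightarrow>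
      (\<Sum>n. (cmod (c (n + k)))\<^sup>2 * R ^ (2 * n))) (at_right R)"
    if c: "\<And>z. summable (\<lambda>n. c n * z ^ n :: complex)" for c
  proof -
    \<comment> \<open>Convergence at \<open>(R + 1)\<^sup>2\<close> puts \<open>R\<^sup>2\<close>
      strictly inside the interval of convergence, where a power series is continuous.\<close>
    have "summable (\<lambda>n. (cmod (c (n + k)))\<^sup>2 * ((R + 1)\<^sup>2) ^ n)"
      using summable_pser_square[OF summable_pser_shift[OF c, of k], of "R + 1"]
      by (simp add: power_mult)
    then have "isCont (\<lambda>t. \<Sum>n. (cmod (c (n + k)))\<^sup>2 * t ^ n) (R\<^sup>2)"
      by (rule isCont_powser) (use R in \<open>simp add: power_strict_mono\<close>)
    then have "isCont (\<lambda>\<rho>. \<Sum>n. (cmod (c (n + k)))\<^sup>2 * (\<rho>\<^sup>2) ^ n) R"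
      by (rule isCont_o2[where f = "\<lambda>\<rho>. \<rho>\<^sup>2", rotated]) (intro continuous_intros)
    then show ?thesis
      unfolding isCont_def power_mult by (rule filterlim_mono[OF _ order_refl at_le]) simp
  qed
  show ?thesis
  proof (rule tendsto_le[OF _ lim[OF b] lim[OF a]])
    show "\<forall>\<^sub>F \<rho> in at_right R. (\<Sum>n. (cmod (a (n + k)))\<^sup>2 * \<rho> ^ (2 * n))
        \<le> (\<Sum>n. (cmod (b (n + k)))\<^sup>2 * \<rho> ^ (2 * n))"
      using eventually_at_right_less[of R]
      by eventually_elim (rule tail_comparison[OF a b \<phi>(1) R _ \<phi>(2,3)])
  qed simp
qed

section \<open>Abel summation\<close>

text \<open>Summation by parts writes the partial sums plus the boundary term
  \<open>w N * T N\<close> as a combination of tails with nonnegative coefficients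
  \<open>w 0\<close> and \<open>w (Suc n) - w n\<close>.\<close>

lemma abel_suminf_nonneg:
  fixes w d :: "nat \<Rightarrow> real"
  assumes w: "incseq w" "0 \<le> w 0" and d: "summable d" and wd: "summable (\<lambda>n. w n * \<bar>d n\<bar>)"
    and tails: "\<And>k. 0 \<le> (\<Sum>n. d (n + k))"
  shows "0 \<le> (\<Sum>n. w n * d n)"
proof -
  define T where "T k = (\<Sum>n. d (n + k))" for k
  define E where "E k = (\<Sum>n. w (n + k) * \<bar>d (n + k)\<bar>)" for k
  have w0: "0 \<le> w n" for n
    using w incseqD[OF w(1), of 0 n] by simp
  have T_rec: "T k = d k + T (Suc k)" for k
    using suminf_split_head[of "\<lambda>n. d (n + k)"] d by (simp add: T_def summable_iff_shift)
  have part: "0 \<le> (\<Sum>n<N. w n * d n) + w N * T N" for N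
  proof (induction N)
    case 0
    then show ?case
      using w0[of 0] tails[of 0] by (simp add: T_def)
  next
    case (Suc N)
    have "(\<Sum>n<Suc N. w n * d n) + w (Suc N) * T (Suc N)
        = (\<Sum>n<N. w n * d n) + w N * T N + (w (Suc N) - w N) * T (Suc N)"
      by (simp add: T_rec[of N] algebra_simps)
    moreover have "0 \<le> (w (Suc N) - w N) * T (Suc N)"
      using w(1) tails[of "Suc N"] by (intro mult_nonneg_nonneg) (auto simp: T_def incseq_Suc_iff)
    ultimately show ?case
      using Suc by linarith
  qed
  \<comment> \<open>Monotonicity allows \<open>w N\<close> to be replaced by
    \<open>w (n + N)\<close> inside the tail. The boundary term is thus at most a tail of the
    convergent series of \<open>w n * \<bar>d n\<bar>\<close>.\<close>
  have "w N * T N \<le> E N" for N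
  proof -
    have s: "summable (\<lambda>n. w (n + N) * \<bar>d (n + N)\<bar>)"
      using wd by (simp add: summable_iff_shift[of "\<lambda>n. w n * \<bar>d n\<bar>"])
    have s': "summable (\<lambda>n. w N * d (n + N))"
      using d by (intro summable_mult) (simp add: summable_iff_shift)
    have "w N * T N = (\<Sum>n. w N * d (n + N))"
      unfolding T_def using d by (intro suminf_mult[symmetric]) (simp add: summable_iff_shift)
    also have "\<dots> \<le> E N"
      unfolding E_def
    proof (rule suminf_le[OF _ s' s])
      fix n
      have "w N * d (n + N) \<le> w N * \<bar>d (n + N)\<bar>"
        using w0 by (intro mult_left_mono) auto
      also have "\<dots> \<le> w (n + N) * \<bar>d (n + N)\<bar>"
        using w(1) by (intro mult_right_mono) (auto simp: incseq_def)
      finally show "w N * d (n + N) \<le> w (n + N) * \<bar>d (n + N)\<bar>" .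
    qed
    finally show ?thesis .
  qed
  then have lower: "0 \<le> (\<Sum>n<N. w n * d n) + E N" for N
    using part[of N] by (smt (verit))
  have "(\<lambda>k. (\<Sum>n. w n * \<bar>d n\<bar>) - (\<Sum>n<k. w n * \<bar>d n\<bar>)) \<longlonglongrightarrow> (\<Sum>n. w n * \<bar>d n\<bar>) - (\<Sum>n. w n * \<bar>d n\<bar>)"
    by (intro tendsto_intros summable_LIMSEQ wd)
  then have E: "E \<longlonglongrightarrow> 0"
    unfolding E_def using suminf_minus_initial_segment[OF wd] by simp
  have "summable (\<lambda>n. w n * d n)"
    by (rule summable_comparison_test'[OF wd, of 0]) (simp add: abs_mult w0)
  then have "(\<lambda>N. (\<Sum>n<N. w n * d n) + E N) \<longlonglongrightarrow> (\<Sum>n. w n * d n) + 0"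
    by (intro tendsto_intros summable_LIMSEQ E)
  then show ?thesis
    using lower by (simp add: LIMSEQ_le_const)
qed

section \<open>Gaussian moments in the plane\<close>

text \<open>Tonelli over the real basis consisting of 1 and \<open>\<i>\<close>; nonnegativity
  permits the passage through \<open>nn_integral\<close>.\<close>

lemma has_bochner_integral_lborel_complex_prod:
  fixes p q :: "real \<Rightarrow> real"
  assumes p: "has_bochner_integral lborel p P" "\<And>x. 0 \<le> p x"
    and q: "has_bochner_integral lborel q Q" "\<And>x. 0 \<le> q x"
  shows "has_bochner_integral lborel (\<lambda>z. p (Re z) * q (Im z)) (P * Q)"
proof -
  define f where "f b = (if b = 1 then p else q)" for b :: complex
  have [measurable]: "p \<in> borel_measurable borel" "q \<in> borel_measurable borel"
    using p(1) q(1) by (auto simp: has_bochner_integral_iff)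
  have PQ: "0 \<le> P" "0 \<le> Q"
    using p q by (auto simp: has_bochner_integral_iff intro: Bochner_Integration.integral_nonneg)
  have "(\<integral>\<^sup>+z. ennreal (p (Re z) * q (Im z)) \<partial>lborel) = (\<integral>\<^sup>+z. (\<Prod>b\<in>Basis. ennreal (f b (z \<bullet> b))) \<partial>lborel)"
    using p(2) q(2) by (intro nn_integral_cong) (simp add: Basis_complex_def f_def complex_eq_iff inner_complex_def ennreal_mult)
  also have "\<dots> = (\<Prod>b\<in>Basis. \<integral>\<^sup>+x. ennreal (f b x) \<partial>lborel)"
    by (rule nn_integral_lborel_prod) (auto simp: f_def)
  also have "\<dots> = ennreal (P * Q)"
    using p q PQ
    by (simp add: Basis_complex_def f_def complex_eq_iff nn_integral_eq_integral has_bochner_integral_iff ennreal_mult)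
  finally show ?thesis
    using p(2) q(2) PQ by (intro has_bochner_integral_nn_integral) auto
qed

text \<open>The Gaussian weight is, up to a constant, a product of two normal densities, so both
  values follow from the moments of order 0 and 2 on the line.\<close>

lemma gaussian_moments_complex:
  assumes \<alpha>: "\<alpha> > 0"
  shows "has_bochner_integral lborel (\<lambda>z. exp (- \<alpha> * (cmod z)\<^sup>2)) (pi / \<alpha>)"
    and "has_bochner_integral lborel (\<lambda>z. (cmod z)\<^sup>2 * exp (- \<alpha> * (cmod z)\<^sup>2)) (pi / \<alpha>\<^sup>2)"
proof -
  \<comment> \<open>Chosen so that the exponent of the normal density,
    \<open>x\<^sup>2 / (2 * \<sigma>\<^sup>2)\<close> up to sign, becomes
    \<open>\<alpha> * x\<^sup>2\<close>.\<close>
  define \<sigma> where "\<sigma> = 1 / sqrt (2 * \<alpha>)"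
  have \<sigma>: "\<sigma> > 0" "\<sigma>\<^sup>2 = 1 / (2 * \<alpha>)"
    using \<alpha> by (simp_all add: \<sigma>_def power_divide)
  define N where "N = normal_density 0 \<sigma>"
  have N0: "has_bochner_integral lborel N 1" and N2: "has_bochner_integral lborel (\<lambda>x. N x * x\<^sup>2) (1 / (2 * \<alpha>))"
    using normal_moment_even[OF \<sigma>(1), of 0 0] normal_moment_even[OF \<sigma>(1), of 0 1] \<alpha> \<sigma>(2)
    by (simp_all add: N_def fact_numeral)
  have nn: "0 \<le> N x" "0 \<le> N x * x\<^sup>2" for x
    by (simp_all add: N_def)
  have N_eq: "N x = sqrt (\<alpha> / pi) * exp (- \<alpha> * x\<^sup>2)" for x
    using \<alpha> unfolding N_def normal_density_def \<sigma>(2) by (simp add: real_sqrt_divide)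
  have NN: "N (Re z) * N (Im z) = \<alpha> / pi * exp (- \<alpha> * (cmod z)\<^sup>2)" for z
  proof -
    have "N (Re z) * N (Im z) = (sqrt (\<alpha> / pi))\<^sup>2 * exp (- \<alpha> * (Re z)\<^sup>2 + - \<alpha> * (Im z)\<^sup>2)"
      unfolding N_eq exp_add by (simp add: power2_eq_square[of "sqrt (\<alpha> / pi)"] del: real_sqrt_mult_self)
    then show ?thesis
      using \<alpha> by (simp add: cmod_power2 algebra_simps)
  qed
  have "has_bochner_integral lborel (\<lambda>z. N (Re z) * N (Im z)) (1 * 1)"
    by (rule has_bochner_integral_lborel_complex_prod[OF N0 nn(1) N0 nn(1)])
  from has_bochner_integral_mult_right[OF this, of "pi / \<alpha>"]
  show "has_bochner_integral lborel (\<lambda>z. exp (- \<alpha> * (cmod z)\<^sup>2)) (pi / \<alpha>)"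
    using \<alpha> by (simp add: NN)
  have "has_bochner_integral lborel (\<lambda>z. N (Re z) * (Re z)\<^sup>2 * N (Im z) + N (Re z) * (N (Im z) * (Im z)\<^sup>2))
      (1 / (2 * \<alpha>) * 1 + 1 * (1 / (2 * \<alpha>)))"
    by (intro has_bochner_integral_add has_bochner_integral_lborel_complex_prod[OF N2 nn(2) N0 nn(1)]
        has_bochner_integral_lborel_complex_prod[OF N0 nn(1) N2 nn(2)])
  moreover have "N (Re z) * (Re z)\<^sup>2 * N (Im z) + N (Re z) * (N (Im z) * (Im z)\<^sup>2)
      = \<alpha> / pi * ((cmod z)\<^sup>2 * exp (- \<alpha> * (cmod z)\<^sup>2))" for z
  proof -
    have "N (Re z) * (Re z)\<^sup>2 * N (Im z) + N (Re z) * (N (Im z) * (Im z)\<^sup>2)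
        = N (Re z) * N (Im z) * (cmod z)\<^sup>2"
      by (simp add: cmod_power2 algebra_simps)
    then show ?thesis
      unfolding NN by simp
  qed
  ultimately have "has_bochner_integral lborel (\<lambda>z. \<alpha> / pi * ((cmod z)\<^sup>2 * exp (- \<alpha> * (cmod z)\<^sup>2))) (1 / \<alpha>)"
    by simp
  from has_bochner_integral_mult_right[OF this, of "pi / \<alpha>"]
  show "has_bochner_integral lborel (\<lambda>z. (cmod z)\<^sup>2 * exp (- \<alpha> * (cmod z)\<^sup>2)) (pi / \<alpha>\<^sup>2)"
    using \<alpha> by (simp add: power2_eq_square mult.assoc)
qed

text \<open>A single term of the exponential series is at most the whole sum.\<close>

lemma power_le_fact_mult_exp:
  fixes x :: real
  assumes "0 \<le> x"
  shows "x ^ n \<le> fact n * exp x"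
proof -
  have "x ^ n /\<^sub>R fact n \<le> (\<Sum>k. x ^ k /\<^sub>R fact k)"
    using sum_le_suminf[OF sums_summable[OF exp_converges[of x]], of "{n}"] assms by simp
  then show ?thesis
    using exp_converges[of x] by (simp add: sums_iff field_simps)
qed

text \<open>For \<alpha> > 0 this is \<open>pi * fact n / \<alpha> ^ (n + 1)\<close>; times
  \<open>\<alpha> / pi\<close> it is the squared Fock norm of the n-th monomial.\<close>

definition gauss_moment :: "real \<Rightarrow> nat \<Rightarrow> real" where
  "gauss_moment \<alpha> n = (LINT z|lborel. cmod z ^ (2 * n) * exp (- \<alpha> * (cmod z)\<^sup>2))"

text \<open>Half of the exponent absorbs the power of \<open>z\<close>, by
  \<open>power_le_fact_mult_exp\<close> with \<open>t = \<alpha> / 2 * (cmod z)\<^sup>2\<close>; the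
  other half is an integrable Gaussian.\<close>

lemma gauss_moment_integrable:
  assumes \<alpha>: "\<alpha> > 0"
  shows "integrable lborel (\<lambda>z. cmod z ^ (2 * n) * exp (- \<alpha> * (cmod z)\<^sup>2))"
proof (rule Bochner_Integration.integrable_bound)
  show "integrable lborel (\<lambda>z::complex. (fact n * (2 / \<alpha>) ^ n) * exp (- (\<alpha>/2) * (cmod z)\<^sup>2))"
    using gaussian_moments_complex(1)[of "\<alpha>/2"] \<alpha>
    by (intro integrable_mult_right) (simp add: has_bochner_integral_iff)
  show "AE z in lborel. norm (cmod z ^ (2 * n) * exp (- \<alpha> * (cmod z)\<^sup>2))
      \<le> norm ((fact n * (2 / \<alpha>) ^ n) * exp (- (\<alpha>/2) * (cmod z)\<^sup>2))"
  proof (rule AE_I2)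
    fix z :: complex
    define t where "t = \<alpha> / 2 * (cmod z)\<^sup>2"
    have "t ^ n \<le> fact n * exp t"
      using \<alpha> by (intro power_le_fact_mult_exp) (simp add: t_def)
    then have "(2 / \<alpha>) ^ n * t ^ n * exp (- 2 * t) \<le> (2 / \<alpha>) ^ n * (fact n * exp t) * exp (- 2 * t)"
      using \<alpha> by (intro mult_right_mono mult_left_mono) auto
    moreover have "(2 / \<alpha>) ^ n * t ^ n = cmod z ^ (2 * n)"
      using \<alpha> by (simp add: t_def power_mult flip: power_mult_distrib)
    moreover have "exp t * exp (- 2 * t) = exp (- t)"
      by (simp flip: exp_add)
    ultimately have "cmod z ^ (2 * n) * exp (- 2 * t) \<le> (2 / \<alpha>) ^ n * fact n * exp (- t)"
      by (metis (no_types, lifting) mult.assoc)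
    then show "norm (cmod z ^ (2 * n) * exp (- \<alpha> * (cmod z)\<^sup>2))
        \<le> norm ((fact n * (2 / \<alpha>) ^ n) * exp (- (\<alpha>/2) * (cmod z)\<^sup>2))"
      using \<alpha> by (simp add: t_def mult_ac abs_mult)
  qed
qed auto

lemma gauss_moment_nonneg: "0 \<le> gauss_moment \<alpha> n"
  unfolding gauss_moment_def by (intro Bochner_Integration.integral_nonneg) auto

text \<open>Integrate \<open>(t - c) * (t ^ n - c ^ n) \<ge> 0\<close> with \<open>t = \<bar>z\<bar>\<^sup>2\<close>, \<open>c = 1 / \<alpha>\<close>; the \<open>c ^ n\<close> term
drops out because the claim is an equality for \<open>n = 0\<close>.\<close>

lemma gauss_moment_Suc_ge:
  assumes \<alpha>: "\<alpha> > 0"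
  shows "gauss_moment \<alpha> n \<le> \<alpha> * gauss_moment \<alpha> (Suc n)"
proof -
  define c where "c = 1 / \<alpha>"
  define m where "m k z = cmod z ^ (2 * k) * exp (- \<alpha> * (cmod z)\<^sup>2)" for k and z :: complex
  have int: "integrable lborel (m k)" for k
    unfolding m_def by (rule gauss_moment_integrable[OF \<alpha>])
  have eq: "integral\<^sup>L lborel (m k) = gauss_moment \<alpha> k" for k
    unfolding m_def gauss_moment_def ..
  have "0 \<le> (LINT z|lborel. (m (Suc n) z - c * m n z) - c ^ n * (m 1 z - c * m 0 z))"
  proof (rule Bochner_Integration.integral_nonneg)
    fix z :: complex
    define t where "t = (cmod z)\<^sup>2"
    have "0 \<le> (t - c) * (t ^ n - c ^ n)"
    proof (cases "c \<le> t")
      case True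
      then show ?thesis
        using \<alpha> by (intro mult_nonneg_nonneg) (auto simp: c_def intro!: power_mono)
    next
      case False
      then show ?thesis
        by (intro mult_nonpos_nonpos) (auto simp: t_def intro!: power_mono)
    qed
    then have "0 \<le> (t - c) * (t ^ n - c ^ n) * exp (- \<alpha> * t)"
      by simp
    also have "\<dots> = (m (Suc n) z - c * m n z) - c ^ n * (m 1 z - c * m 0 z)"
      by (simp add: m_def t_def power_mult algebra_simps power2_eq_square)
    finally show "0 \<le> (m (Suc n) z - c * m n z) - c ^ n * (m 1 z - c * m 0 z)" .
  qed
  also have "\<dots> = (gauss_moment \<alpha> (Suc n) - c * gauss_moment \<alpha> n) - c ^ n * (gauss_moment \<alpha> 1 - c * gauss_moment \<alpha> 0)"
    using int by (simp add: eq)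
  also have "gauss_moment \<alpha> 1 - c * gauss_moment \<alpha> 0 = 0"
    using gaussian_moments_complex[OF \<alpha>] \<alpha>
    by (simp add: gauss_moment_def has_bochner_integral_iff c_def power2_eq_square)
  finally show ?thesis
    using \<alpha> by (simp add: c_def field_simps)
qed

section \<open>The Fock norm in terms of Taylor coefficients\<close>

lemma nn_integral_rotation:
  fixes f :: "complex \<Rightarrow> ennreal"
  assumes [measurable]: "f \<in> borel_measurable borel" and c: "cmod c = 1"
  shows "(\<integral>\<^sup>+z. f (c * z) \<partial>lborel) = (\<integral>\<^sup>+z. f z \<partial>lborel)"
proof -
  have "(\<integral>\<^sup>+z. f z \<partial>lborel) = (\<integral>\<^sup>+z. f z \<partial>distr lborel borel ((*) c))"
    by (simp add: lborel_distr_rotation[OF c])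
  also have "\<dots> = (\<integral>\<^sup>+z. f (c * z) \<partial>lborel)"
    by (rule nn_integral_distr) auto
  finally show ?thesis ..
qed

text \<open>Averaging over rotations takes the place of polar coordinates. The double integral of
  \<open>F\<close> is computed in both orders: over \<open>z\<close> first, rotation invariance
  gives \<open>2 * pi\<close> times the left side; over the angle first, Parseval gives the series.
  In \<open>ennreal\<close> the identity includes the case of infinite norm.\<close>

lemma nn_integral_pser_gauss:
  assumes \<alpha>: "\<alpha> > 0" and a: "\<And>z. summable (\<lambda>n. a n * z ^ n :: complex)"
  shows "(\<integral>\<^sup>+z. ennreal ((cmod (pser a z))\<^sup>2 * exp (- \<alpha> * (cmod z)\<^sup>2)) \<partial>lborel)
    = (\<Sum>n. ennreal ((cmod (a n))\<^sup>2 * gauss_moment \<alpha> n))"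
proof -
  define w where "w z = exp (- \<alpha> * (cmod z)\<^sup>2)" for z :: complex
  define F where "F z \<theta> = ennreal ((cmod (pser a (z * cis \<theta>)))\<^sup>2 * w z) * indicator {0..2*pi} \<theta>" for z \<theta>
  define I where "I = (\<integral>\<^sup>+z. ennreal ((cmod (pser a z))\<^sup>2 * w z) \<partial>lborel)"
  have cont: "continuous_on UNIV (pser a)"
    by (intro holomorphic_on_imp_continuous_on holomorphic_pser a)
  have [measurable]: "pser a \<in> borel_measurable borel"
    using cont by (rule borel_measurable_continuous_onI)
  have [measurable]: "w \<in> borel_measurable borel"
    unfolding w_def by simp
  have "(\<lambda>p. fst p * cis (snd p)) \<in> borel_measurable (borel :: (complex \<times> real) measure)"
    by (intro borel_measurable_continuous_onI continuous_intros)
  then have [measurable]: "(\<lambda>p. fst p * cis (snd p)) \<in> borel_measurable (lborel \<Otimes>\<^sub>M lborel)"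
    by (simp add: lborel_prod)
  have F_meas: "case_prod F \<in> borel_measurable (lborel \<Otimes>\<^sub>M lborel)"
    unfolding F_def case_prod_beta by measurable
  \<comment> \<open>The weight depends only on the modulus of \<open>z\<close>, so the whole
    integrand is a rotated copy of the one in \<open>I\<close>.\<close>
  have inner1: "(\<integral>\<^sup>+z. F z \<theta> \<partial>lborel) = I * indicator {0..2*pi} \<theta>" for \<theta>
  proof -
    have "(\<integral>\<^sup>+z. F z \<theta> \<partial>lborel) = (\<integral>\<^sup>+z. ennreal ((cmod (pser a (cis \<theta> * z)))\<^sup>2 * w (cis \<theta> * z)) \<partial>lborel) * indicator {0..2*pi} \<theta>"
      unfolding F_def by (subst nn_integral_multc) (simp_all add: w_def norm_mult mult.commute)
    also have "(\<integral>\<^sup>+z. ennreal ((cmod (pser a (cis \<theta> * z)))\<^sup>2 * w (cis \<theta> * z)) \<partial>lborel) = I"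
      unfolding I_def by (rule nn_integral_rotation) auto
    finally show ?thesis .
  qed
  have inner2: "(\<integral>\<^sup>+\<theta>. F z \<theta> \<partial>lborel) = (\<Sum>n. ennreal (2 * pi * (cmod (a n))\<^sup>2 * (cmod z ^ (2 * n) * w z)))" for z
  proof -
    define J where "J = integral {0..2*pi} (\<lambda>\<theta>. (cmod (pser a (z * cis \<theta>)))\<^sup>2)"
    have "((\<lambda>\<theta>. (cmod (pser a (z * cis \<theta>)))\<^sup>2 * w z) has_integral J * w z) {0..2*pi}"
      unfolding J_def by (intro has_integral_mult_left integrable_integral circle_integrable_pser a)
    then have "(\<integral>\<^sup>+\<theta>. ennreal (indicator {0..2*pi} \<theta> * ((cmod (pser a (z * cis \<theta>)))\<^sup>2 * w z)) \<partial>lborel) = ennreal (J * w z)"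
      by (intro nn_integral_has_integral_lebesgue) (simp_all add: w_def)
    moreover have "(\<lambda>n. 2 * pi * (cmod (a n))\<^sup>2 * (cmod z ^ (2 * n) * w z)) sums (J * w z)"
      using sums_mult2[OF circle_parseval[OF a, of z], of "w z"] by (simp add: J_def mult_ac)
    then have "(\<Sum>n. ennreal (2 * pi * (cmod (a n))\<^sup>2 * (cmod z ^ (2 * n) * w z))) = ennreal (J * w z)"
      by (intro suminf_ennreal_eq) (simp_all add: w_def)
    ultimately show ?thesis
      unfolding F_def by (simp add: ennreal_mult'' ennreal_indicator mult_ac flip: ennreal_indicator)
  qed
  have "ennreal (2 * pi) * I = (\<integral>\<^sup>+\<theta>. I * indicator {0..2*pi} \<theta> \<partial>lborel)"
    by (subst nn_integral_cmult) (simp_all add: mult.commute)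
  also have "\<dots> = (\<integral>\<^sup>+\<theta>. (\<integral>\<^sup>+z. F z \<theta> \<partial>lborel) \<partial>lborel)"
    by (simp add: inner1)
  also have "\<dots> = (\<integral>\<^sup>+z. (\<integral>\<^sup>+\<theta>. F z \<theta> \<partial>lborel) \<partial>lborel)"
    by (rule lborel_pair.Fubini'[OF F_meas])
  also have "\<dots> = (\<Sum>n. \<integral>\<^sup>+z. ennreal (2 * pi * (cmod (a n))\<^sup>2 * (cmod z ^ (2 * n) * w z)) \<partial>lborel)"
    unfolding inner2 by (rule nn_integral_suminf) simp
  also have "\<dots> = (\<Sum>n. ennreal (2 * pi) * ennreal ((cmod (a n))\<^sup>2 * gauss_moment \<alpha> n))"
  proof (rule suminf_cong)
    fix n
    have "(\<integral>\<^sup>+z. ennreal (2 * pi * (cmod (a n))\<^sup>2 * (cmod z ^ (2 * n) * w z)) \<partial>lborel)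
        = ennreal (LINT z|lborel. 2 * pi * (cmod (a n))\<^sup>2 * (cmod z ^ (2 * n) * w z))"
      unfolding w_def
      by (intro nn_integral_eq_integral integrable_mult_right gauss_moment_integrable[OF \<alpha>]) auto
    also have "\<dots> = ennreal (2 * pi) * ennreal ((cmod (a n))\<^sup>2 * gauss_moment \<alpha> n)"
      unfolding w_def by (simp add: gauss_moment_def gauss_moment_nonneg mult.assoc flip: ennreal_mult')
    finally show "(\<integral>\<^sup>+z. ennreal (2 * pi * (cmod (a n))\<^sup>2 * (cmod z ^ (2 * n) * w z)) \<partial>lborel)
        = ennreal (2 * pi) * ennreal ((cmod (a n))\<^sup>2 * gauss_moment \<alpha> n)" .
  qed
  also have "\<dots> = ennreal (2 * pi) * (\<Sum>n. ennreal ((cmod (a n))\<^sup>2 * gauss_moment \<alpha> n))"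
    by simp
  \<comment> \<open>The factor \<open>2 * pi\<close> is positive and finite, so it cancels even when
    \<open>I\<close> is infinite.\<close>
  finally show ?thesis
    unfolding I_def w_def by (subst (asm) ennreal_mult_cancel_left) auto
qed

text \<open>Finiteness of the integral makes the extended series finite, which yields summability
  and lets the identity descend to the reals.\<close>

lemma fock_space_coeffs:
  assumes \<alpha>: "\<alpha> > 0" and f: "f \<in> fock_space \<alpha>"
  obtains a where "f = pser a" "\<And>z. summable (\<lambda>n. a n * z ^ n)"
    "(\<lambda>n. (cmod (a n))\<^sup>2 * gauss_moment \<alpha> n) sums (LINT z|lborel. (cmod (f z))\<^sup>2 * exp (- \<alpha> * (cmod z)\<^sup>2))"
proof -
  define a where "a n = (deriv ^^ n) f 0 / fact n" for n
  have hol: "f holomorphic_on UNIV"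
    and int: "integrable lborel (\<lambda>z. (cmod (f z))\<^sup>2 * exp (- \<alpha> * (cmod z)\<^sup>2))"
    using f by (auto simp: fock_space_def)
  have sums: "(\<lambda>n. a n * z ^ n) sums f z" for z
    using holomorphic_power_series[of f 0 "cmod z + 1" z] holomorphic_on_subset[OF hol]
    by (simp add: a_def)
  then have a: "f = pser a" "\<And>z. summable (\<lambda>n. a n * z ^ n)"
    by (auto simp: pser_def sums_iff)
  define L where "L = (LINT z|lborel. (cmod (f z))\<^sup>2 * exp (- \<alpha> * (cmod z)\<^sup>2))"
  have L: "(\<Sum>n. ennreal ((cmod (a n))\<^sup>2 * gauss_moment \<alpha> n)) = ennreal L"
    using nn_integral_pser_gauss[OF \<alpha> a(2)] nn_integral_eq_integral[OF int]
    by (simp add: a(1)[symmetric] L_def)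
  have nn: "0 \<le> (cmod (a n))\<^sup>2 * gauss_moment \<alpha> n" for n
    by (simp add: gauss_moment_nonneg)
  have summ: "summable (\<lambda>n. (cmod (a n))\<^sup>2 * gauss_moment \<alpha> n)"
    using nn L by (intro summable_suminf_not_top) auto
  have "ennreal (\<Sum>n. (cmod (a n))\<^sup>2 * gauss_moment \<alpha> n) = ennreal L"
    using L suminf_ennreal2[OF nn summ] by simp
  moreover have "0 \<le> L"
    unfolding L_def by (intro Bochner_Integration.integral_nonneg) auto
  ultimately have "(\<Sum>n. (cmod (a n))\<^sup>2 * gauss_moment \<alpha> n) = L"
    using suminf_nonneg[OF summ nn] by simp
  with summ have "(\<lambda>n. (cmod (a n))\<^sup>2 * gauss_moment \<alpha> n) sums L"
    by (simp add: sums_iff)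
  with a show thesis
    unfolding L_def by (rule that)
qed

section \<open>Norm comparison and sharpness of the radius\<close>

lemma fock_norm_mono:
  assumes \<alpha>: "\<alpha> > 0" and f: "f \<in> fock_space \<alpha>" and g: "g \<in> fock_space \<alpha>"
    and le: "\<And>z. cmod z > 1 / sqrt \<alpha> \<Longrightarrow> cmod (f z) \<le> cmod (g z)"
  shows "fock_norm \<alpha> f \<le> fock_norm \<alpha> g"
proof -
  define R where "R = 1 / sqrt \<alpha>"
  have R: "R > 0" and R2: "R\<^sup>2 = 1 / \<alpha>"
    using \<alpha> by (simp_all add: R_def power_divide)
  obtain a where a: "f = pser a" "\<And>z. summable (\<lambda>n. a n * z ^ n)"
    "(\<lambda>n. (cmod (a n))\<^sup>2 * gauss_moment \<alpha> n) sums (LINT z|lborel. (cmod (f z))\<^sup>2 * exp (- \<alpha> * (cmod z)\<^sup>2))"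
    using fock_space_coeffs[OF \<alpha> f] by blast
  obtain b where b: "g = pser b" "\<And>z. summable (\<lambda>n. b n * z ^ n)"
    "(\<lambda>n. (cmod (b n))\<^sup>2 * gauss_moment \<alpha> n) sums (LINT z|lborel. (cmod (g z))\<^sup>2 * exp (- \<alpha> * (cmod z)\<^sup>2))"
    using fock_space_coeffs[OF \<alpha> g] by blast
  \<comment> \<open>Since \<open>R\<^sup>2 = 1 / \<alpha>\<close>, the powers cancel in
    \<open>w n * d n\<close>, whose sum is the difference of the two norm integrals. The weights
    increase by \<open>gauss_moment_Suc_ge\<close>, and the tails of \<open>d\<close> are those of
    the coefficient comparison at radius \<open>R\<close>.\<close>
  define w where "w n = \<alpha> ^ n * gauss_moment \<alpha> n" for n
  define d where "d n = (cmod (b n))\<^sup>2 * R ^ (2 * n) - (cmod (a n))\<^sup>2 * R ^ (2 * n)" for n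
  have wd: "w n * d n = (cmod (b n))\<^sup>2 * gauss_moment \<alpha> n - (cmod (a n))\<^sup>2 * gauss_moment \<alpha> n" for n
  proof -
    have "\<alpha> ^ n * R ^ (2 * n) = 1"
      using \<alpha> by (simp add: power_mult R2 flip: power_mult_distrib)
    moreover have "w n * d n = (\<alpha> ^ n * R ^ (2 * n)) *
        ((cmod (b n))\<^sup>2 * gauss_moment \<alpha> n - (cmod (a n))\<^sup>2 * gauss_moment \<alpha> n)"
      by (simp add: w_def d_def algebra_simps)
    ultimately show ?thesis
      by simp
  qed
  have w_nonneg: "0 \<le> w n" for n
    using \<alpha> by (simp add: w_def gauss_moment_nonneg)
  have "0 \<le> (\<Sum>n. w n * d n)"
  proof (rule abel_suminf_nonneg)
    show "incseq w"
      unfolding incseq_Suc_iff w_def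
      using gauss_moment_Suc_ge[OF \<alpha>] \<alpha> by (simp add: mult_ac)
    show "0 \<le> w 0"
      by (rule w_nonneg)
    show "summable d"
      unfolding d_def by (intro summable_diff summable_pser_square a(2) b(2))
    \<comment> \<open>By \<open>wd\<close> the terms are bounded by those of the sum of the two
      convergent norm series.\<close>
    show "summable (\<lambda>n. w n * \<bar>d n\<bar>)"
    proof (rule summable_comparison_test')
      show "summable (\<lambda>n. (cmod (b n))\<^sup>2 * gauss_moment \<alpha> n + (cmod (a n))\<^sup>2 * gauss_moment \<alpha> n)"
        using a(3) b(3) by (intro summable_add) (auto simp: sums_iff)
      fix n
      have "norm (w n * \<bar>d n\<bar>) = \<bar>w n * d n\<bar>"
        by (simp add: abs_mult)
      also have "\<dots> \<le> (cmod (b n))\<^sup>2 * gauss_moment \<alpha> n + (cmod (a n))\<^sup>2 * gauss_moment \<alpha> n"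
        unfolding wd using gauss_moment_nonneg[of \<alpha> n]
        by (intro order.trans[OF abs_triangle_ineq4]) (simp add: abs_mult)
      finally show "norm (w n * \<bar>d n\<bar>) \<le> (cmod (b n))\<^sup>2 * gauss_moment \<alpha> n + (cmod (a n))\<^sup>2 * gauss_moment \<alpha> n" .
    qed
    fix k
    have summ: "summable (\<lambda>n. (cmod (c (n + k)))\<^sup>2 * R ^ (2 * n))"
      if "\<And>z. summable (\<lambda>n. c n * z ^ n :: complex)" for c
      by (intro summable_pser_square summable_pser_shift that)
    \<comment> \<open>The tail comparison weights the shifted coefficients by
      \<open>R ^ (2 * n)\<close>, so the common factor \<open>R ^ (2 * k)\<close> is taken
      out.\<close>
    have "d (n + k) = R ^ (2 * k) * ((cmod (b (n + k)))\<^sup>2 * R ^ (2 * n) - (cmod (a (n + k)))\<^sup>2 * R ^ (2 * n))" for n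
      by (simp add: d_def algebra_simps power_add)
    then have "(\<Sum>n. d (n + k)) = R ^ (2 * k) * ((\<Sum>n. (cmod (b (n + k)))\<^sup>2 * R ^ (2 * n)) - (\<Sum>n. (cmod (a (n + k)))\<^sup>2 * R ^ (2 * n)))"
      using summ[OF a(2)] summ[OF b(2)] by (simp add: suminf_mult suminf_diff summable_diff)
    moreover have "(\<Sum>n. (cmod (a (n + k)))\<^sup>2 * R ^ (2 * n)) \<le> (\<Sum>n. (cmod (b (n + k)))\<^sup>2 * R ^ (2 * n))"
      using a(1) b(1) le by (intro tail_comparison_limit a(2) b(2) R) (simp add: R_def)
    ultimately show "0 \<le> (\<Sum>n. d (n + k))"
      using R by simp
  qed
  then have "(LINT z|lborel. (cmod (f z))\<^sup>2 * exp (- \<alpha> * (cmod z)\<^sup>2))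
      \<le> (LINT z|lborel. (cmod (g z))\<^sup>2 * exp (- \<alpha> * (cmod z)\<^sup>2))"
    using sums_diff[OF b(3) a(3)] by (simp add: wd sums_iff)
  then show ?thesis
    unfolding fock_norm_def using \<alpha> by (intro real_sqrt_le_mono mult_left_mono) auto
qed

text \<open>The constant \<open>R\<close> is dominated by the identity outside the disc of radius
  \<open>R\<close>. Their squared norms are \<open>R\<^sup>2\<close> and
  \<open>1 / \<alpha>\<close>, by the moments of order 0 and 2.\<close>

lemma fock_admissible_le:
  assumes \<alpha>: "\<alpha> > 0" and adm: "fock_admissible \<alpha> R"
  shows "R \<le> 1 / sqrt \<alpha>"
proof -
  have R: "R > 0"
    using adm by (simp add: fock_admissible_def)
  note m = gaussian_moments_complex[OF \<alpha>]
  have "(\<lambda>_. of_real R) \<in> fock_space \<alpha>" "(\<lambda>z. z) \<in> fock_space \<alpha>"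
    using m by (auto simp: fock_space_def has_bochner_integral_iff)
  moreover have "cmod (of_real R) \<le> cmod z" if "cmod z > R" for z
    using that R by simp
  ultimately have "fock_norm \<alpha> (\<lambda>_. of_real R) \<le> fock_norm \<alpha> (\<lambda>z. z)"
    by (rule adm[unfolded fock_admissible_def, THEN conjunct2, rule_format])
  then have "R\<^sup>2 \<le> 1 / \<alpha>"
    using m \<alpha> R by (simp add: fock_norm_def has_bochner_integral_iff power2_eq_square)
  then show ?thesis
    using real_le_rsqrt[of R "1 / \<alpha>"] by (simp add: real_sqrt_divide)
qed

theorem corollary5p2:
  fixes \<alpha> :: real
  assumes "\<alpha> > 0"
  shows "(\<forall>f\<in>fock_space \<alpha>. \<forall>g\<in>fock_space \<alpha>.
            (\<forall>z. cmod z > 1 / sqrt \<alpha> \<longrightarrow> cmod (f z) \<le> cmod (g z))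
              \<longrightarrow> fock_norm \<alpha> f \<le> fock_norm \<alpha> g)
         \<and> korenblum_radius \<alpha> = ereal (1 / sqrt \<alpha>)"
proof
  show *: "\<forall>f\<in>fock_space \<alpha>. \<forall>g\<in>fock_space \<alpha>.
      (\<forall>z. cmod z > 1 / sqrt \<alpha> \<longrightarrow> cmod (f z) \<le> cmod (g z)) \<longrightarrow> fock_norm \<alpha> f \<le> fock_norm \<alpha> g"
    using fock_norm_mono[OF assms] by blast
  then have "fock_admissible \<alpha> (1 / sqrt \<alpha>)"
    using assms by (simp add: fock_admissible_def)
  then show "korenblum_radius \<alpha> = ereal (1 / sqrt \<alpha>)"
    unfolding korenblum_radius_def using fock_admissible_le[OF assms]
    by (intro antisym SUP_least SUP_upper) auto
qed

end
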